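(* Let $n\in\mathbb{N}$ and let $R$ be an $(n+1)$-simple Ore domain of stable range $n$. For each matrix $A\in R^{(n+1)\times(n+1)}$ that is a non-zero divisor (in the ring $R^{(n+1)\times(n+1)}$) there exist $P,Q\in GL_{n+1}(R)$ and $A_0\in R^{n\times n}$ such that $$PAQ=\begin{pmatrix}1&0\\0&A_0\end{pmatrix},$$ where the off-diagonal blocks are the zero row of length $n$ and the zero column of length $n$.
   Context: Rings are associative (not necessarily commutative) with nonzero unit; $\mathbb{N}$ is the set of positive integers. $R^{r\times s}$ denotes the set of $r\times s$ matrices over $R$, and $GL_n(R)$ is the group of units of $R^{n\times n}$. A domain $R$ is a right (left) Ore domain if $aR\cap bR\ne\{0\}$ (respectively $Ra\cap Rb\neq\{0\}$) for all $a,b\in R\setminus\{0\}$; an Ore domain is a domain that is both right and left Ore. A ring $R$ is simple if it has no two-sided ideals other than $0$ and $R$. A simple ring $R$ is called $m$-simple ($m\in\mathbb{N}$) if $m$ is the minimal positive integer such that for every $a\in R\setminus\{0\}$ there exist $u_1,\ldots,u_m,v_1,\ldots,v_m\in R$ with $u_1av_1+\cdots+u_mav_m=1$. A row $(a_1,\ldots,a_k)\in R^k$ is unimodular if $a_1R+\cdots+a_kR=R$. A unimodular row $(a_1,\ldots,a_k)$ is reducible if there exist $b_1,\ldots,b_{k-1}\in R$ such that $(a_1+a_kb_1,\,a_2+a_kb_2,\ldots,a_{k-1}+a_kb_{k-1})$ is unimodular. $R$ has stable range $n$ if $n\in\mathbb{N}$ is the smallest number such that every unimodular $(n+1)$-row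 is reducible; in particular $R$ has stable range $1$ if $aR+bR=R$ implies $(a+bt)R=R$ for some $t\in R$. *)

theory Defs
  imports "HOL-Algebra.Ideal" "Jordan_Normal_Form.VS_Connect"
begin

text \<open>
  The ring \<open>R\<close> is the universe of a type \<open>'a\<close>; a (not necessarily commutative) domain with nonzero
  unit is a type of class \<open>ring_1_no_zero_divisors\<close>. Matrices and rows over it are those of
  Jordan_Normal_Form, whose product only needs a noncommutative semiring.
\<close>

definition right_ore_domain :: "'a::ring_1_no_zero_divisors itself \<Rightarrow> bool" where
  "right_ore_domain TYPE('a) \<longleftrightarrow>
    (\<forall>a b :: 'a. a \<noteq> 0 \<longrightarrow> b \<noteq> 0 \<longrightarrow> {a * r | r. True} \<inter> {b * r | r. True} \<noteq> {0})"

definition left_ore_domain :: "'a::ring_1_no_zero_divisors itself \<Rightarrow> bool" where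
  "left_ore_domain TYPE('a) \<longleftrightarrow>
    (\<forall>a b :: 'a. a \<noteq> 0 \<longrightarrow> b \<noteq> 0 \<longrightarrow> {r * a | r. True} \<inter> {r * b | r. True} \<noteq> {0})"

definition ore_domain :: "'a::ring_1_no_zero_divisors itself \<Rightarrow> bool" where
  "ore_domain TYPE('a) \<longleftrightarrow> right_ore_domain TYPE('a) \<and> left_ore_domain TYPE('a)"

text \<open>The predicate \<open>ideal\<close> of HOL-Algebra means two-sided ideal.\<close>

definition simple_ring :: "'a::ring_1 itself \<Rightarrow> bool" where
  "simple_ring TYPE('a) \<longleftrightarrow> (\<forall>I. ideal I (class_ring :: 'a ring) \<longrightarrow> I = {0} \<or> I = UNIV)"

definition one_as_sum_of_multiples :: "'a::ring_1 itself \<Rightarrow> nat \<Rightarrow> bool" where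
  "one_as_sum_of_multiples TYPE('a) m \<longleftrightarrow>
    (\<forall>a :: 'a. a \<noteq> 0 \<longrightarrow> (\<exists>u v. (\<Sum>i = 1..m. u i * a * v i) = 1))"

definition m_simple :: "'a::ring_1 itself \<Rightarrow> nat \<Rightarrow> bool" where
  "m_simple TYPE('a) m \<longleftrightarrow> simple_ring TYPE('a) \<and> 1 \<le> m \<and> one_as_sum_of_multiples TYPE('a) m \<and>
    (\<forall>k. 1 \<le> k \<and> one_as_sum_of_multiples TYPE('a) k \<longrightarrow> m \<le> k)"

text \<open>The right ideal generated by the entries of \<open>a\<close> consists of the scalar products \<open>a \<bullet> r\<close>, in
  which the entries of \<open>a\<close> stand on the left.\<close>

definition unimodular_row :: "'a::ring_1 vec \<Rightarrow> bool" where
  "unimodular_row a \<longleftrightarrow> {a \<bullet> r | r. r \<in> carrier_vec (dim_vec a)} = UNIV"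

text \<open>Vectors are indexed from 0, so the last entry of a row \<open>a\<close> of length \<open>k + 1\<close> is \<open>a $ k\<close>.\<close>

definition reducible_row :: "'a::ring_1 vec \<Rightarrow> bool" where
  "reducible_row a \<longleftrightarrow>
    (let k = dim_vec a - 1 in
      \<exists>b \<in> carrier_vec k. unimodular_row (vec k (\<lambda>i. a $ i + a $ k * b $ i)))"

definition unimodular_rows_reducible :: "'a::ring_1 itself \<Rightarrow> nat \<Rightarrow> bool" where
  "unimodular_rows_reducible TYPE('a) k \<longleftrightarrow>
    (\<forall>a :: 'a vec. a \<in> carrier_vec k \<longrightarrow> unimodular_row a \<longrightarrow> reducible_row a)"

definition has_stable_range :: "'a::ring_1 itself \<Rightarrow> nat \<Rightarrow> bool" where
  "has_stable_range TYPE('a) n \<longleftrightarrow> 1 \<le> n \<and> unimodular_rows_reducible TYPE('a) (n + 1) \<and>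
    (\<forall>k. 1 \<le> k \<and> unimodular_rows_reducible TYPE('a) (k + 1) \<longrightarrow> n \<le> k)"

definition non_zero_divisor :: "('a, 'b) ring_scheme \<Rightarrow> 'a \<Rightarrow> bool" where
  "non_zero_divisor S a \<longleftrightarrow> a \<in> carrier S \<and>
    (\<forall>b \<in> carrier S. b \<noteq> \<zero>\<^bsub>S\<^esub> \<longrightarrow> a \<otimes>\<^bsub>S\<^esub> b \<noteq> \<zero>\<^bsub>S\<^esub> \<and> b \<otimes>\<^bsub>S\<^esub> a \<noteq> \<zero>\<^bsub>S\<^esub>)"

definition GL :: "'a::ring_1 itself \<Rightarrow> nat \<Rightarrow> 'a mat set" where
  "GL TYPE('a) n = Units (ring_mat TYPE('a) n ())"

end

theory Submission
  imports Defs
begin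

text \<open>
  The point is to find a row \<open>u\<close> and a column \<open>v\<close> with \<open>u * A * v = 1\<close>. Over the division ring of
  fractions the non-zero divisor \<open>A\<close> is invertible, and clearing denominators on the right gives a
  matrix \<open>B\<close> and a scalar \<open>d \<noteq> 0\<close> with \<open>A * B\<close> the scalar matrix \<open>d\<close>
  (\<open>scalar_right_multiple\<close>). By \<open>(n + 1)\<close>-simplicity,
  \<open>p\<^sub>1 * d * q\<^sub>1 + \<dots> + p\<^bsub>n+1\<^esub> * d * q\<^bsub>n+1\<^esub> = 1\<close>; the number of summands is exactly the size of
  \<open>A\<close>, so this reads \<open>u * (A * B) * w = 1\<close> with \<open>u\<close> the row of the \<open>p\<close>s and \<open>w\<close> the column of
  the \<open>q\<close>s, and \<open>v = B * w\<close> is as wanted.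

  Now \<open>u\<close> and \<open>u * A\<close> are unimodular rows of length \<open>n + 1\<close>. By stable range \<open>n\<close> such a
  row becomes the first unit row after multiplication by some element of \<open>GL\<close> on the right
  (\<open>unimodular_row_to_first_unit_row\<close>). Applied
  to \<open>u\<close>, this makes \<open>u\<close> the first row of an invertible \<open>P\<close>; applied to \<open>u * A\<close>, it yields \<open>Q\<close> such
  that \<open>P * A * Q\<close> has the first unit row as its first row. Row operations then clear the first
  column (\<open>split_off_unit\<close>).
\<close>

section \<open>Linear systems over a right Ore domain\<close>

lemma right_ore_common_multiple:
  fixes a b :: "'a::ring_1_no_zero_divisors"
  assumes "right_ore_domain TYPE('a)" "a \<noteq> 0"
  obtains s t where "a * s = b * t" "t \<noteq> 0"
proof (cases "b = 0")
  case True
  then show ?thesis using that[of 0 1] by simp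
next
  case False
  have "{a * r | r. True} \<inter> {b * r | r. True} \<noteq> {0}"
    using assms False by (auto simp: right_ore_domain_def)
  moreover have "0 \<in> {a * r | r. True} \<inter> {b * r | r. True}"
    by (auto intro: exI[of _ 0])
  ultimately obtain c where "c \<in> {a * r | r. True}" "c \<in> {b * r | r. True}" "c \<noteq> 0"
    by blast
  then obtain s t where "c = a * s" "c = b * t" by blast
  then show ?thesis using that \<open>c \<noteq> 0\<close> by (metis mult_zero_right)
qed

lemma right_ore_finite_common_multiple:
  fixes d :: "nat \<Rightarrow> 'a::ring_1_no_zero_divisors"
  assumes ore: "right_ore_domain TYPE('a)" and "\<And>i. i < k \<Longrightarrow> d i \<noteq> 0"
  shows "\<exists>c s. c \<noteq> 0 \<and> (\<forall>i<k. d i * s i = c)"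
  using assms(2)
proof (induction k)
  case 0
  show ?case by (auto intro: exI[of _ 1])
next
  case (Suc k)
  then obtain c s where cs: "c \<noteq> 0" "\<forall>i<k. d i * s i = c" by force
  obtain x y where xy: "d k * x = c * y" "y \<noteq> 0"
    using right_ore_common_multiple[OF ore] Suc.prems by (metis lessI)
  have "\<forall>i<Suc k. d i * (if i = k then x else s i * y) = c * y"
    using cs xy by (auto simp: less_Suc_eq mult.assoc[symmetric])
  moreover have "c * y \<noteq> 0" using cs xy by simp
  ultimately show ?case
    by (intro exI[of _ "c * y"] exI[of _ "\<lambda>i. if i = k then x else s i * y"]) simp
qed

text \<open>
  Gaussian elimination, carried out on the columns because only right multiples are available: a
  column whose last entry is nonzero serves as pivot, and the last entry of every other column is
  cancelled by subtracting a right multiple of the pivot from a nonzero right multiple of that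
  column. The absence of zero divisors keeps a nontrivial relation between the new columns
  nontrivial as a relation between the old ones.
\<close>

lemma right_ore_columns_dependent:
  fixes f :: "nat \<Rightarrow> 'b \<Rightarrow> 'a::ring_1_no_zero_divisors"
  assumes ore: "right_ore_domain TYPE('a)" and "finite J" "k < card J"
  shows "\<exists>x. (\<exists>j\<in>J. x j \<noteq> 0) \<and> (\<forall>i<k. (\<Sum>j\<in>J. f i j * x j) = 0)"
  using assms(2-)
proof (induction k arbitrary: J f)
  case 0
  then have "J \<noteq> {}" by auto
  then show ?case by (intro exI[of _ "\<lambda>_. 1"]) auto
next
  case (Suc k)
  show ?case
  proof (cases "\<exists>p\<in>J. f k p \<noteq> 0")
    case False
    from Suc.IH[of J f] Suc.prems obtain x
      where "\<exists>j\<in>J. x j \<noteq> 0" "\<forall>i<k. (\<Sum>j\<in>J. f i j * x j) = 0" by force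
    then show ?thesis using False by (auto simp: less_Suc_eq)
  next
    case True
    then obtain p where p: "p \<in> J" "f k p \<noteq> 0" by blast
    define K where "K = J - {p}"
    have "\<exists>t s. f k p * t = f k j * s \<and> s \<noteq> 0" for j
      using right_ore_common_multiple[OF ore p(2)] by metis
    then obtain t s where ts: "\<And>j. f k p * t j = f k j * s j" "\<And>j. s j \<noteq> 0"
      by metis
    have K: "finite K" "k < card K" "p \<notin> K" "J = insert p K"
      using Suc.prems p by (auto simp: K_def)
    obtain y where y: "\<exists>j\<in>K. y j \<noteq> 0"
      "\<forall>i<k. (\<Sum>j\<in>K. (f i j * s j - f i p * t j) * y j) = 0"
      using Suc.IH[OF K(1,2), of "\<lambda>i j. f i j * s j - f i p * t j"] by blast
    \<comment> \<open>The coefficient of the pivot column collects what was subtracted from the other columns.\<close>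
    define x where "x j = (if j = p then - (\<Sum>j\<in>K. t j * y j) else s j * y j)" for j
    have eq: "(\<Sum>j\<in>J. f i j * x j) = (\<Sum>j\<in>K. (f i j * s j - f i p * t j) * y j)" for i
    proof -
      have "(\<Sum>j\<in>K. f i j * x j) = (\<Sum>j\<in>K. f i j * s j * y j)"
        using K by (intro sum.cong) (auto simp: x_def mult.assoc)
      moreover have "f i p * x p = - (\<Sum>j\<in>K. f i p * t j * y j)"
        by (simp add: x_def sum_distrib_left mult.assoc)
      ultimately show ?thesis
        using K by (simp add: left_diff_distrib sum_subtractf)
    qed
    have "(\<Sum>j\<in>J. f i j * x j) = 0" if "i < Suc k" for i
      using that y(2) ts(1) unfolding eq by (auto simp: less_Suc_eq)
    moreover have "\<exists>j\<in>J. x j \<noteq> 0"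
    proof -
      from y(1) obtain j where "j \<in> K" "y j \<noteq> 0" by blast
      then show ?thesis using ts(2) K by (intro bexI[of _ j]) (auto simp: x_def)
    qed
    ultimately show ?thesis by blast
  qed
qed

text \<open>
  Over the division ring of fractions \<open>A\<close> would have an inverse, and \<open>d\<close> is a common right
  denominator of its entries. Working column by column avoids the fractions: the \<open>N + 1\<close> columns
  formed by a unit vector and the columns of \<open>A\<close> are dependent, and the unit vector must occur in
  the relation since \<open>A\<close> annihilates no nonzero column.
\<close>

lemma scalar_right_multiple:
  fixes A :: "'a::ring_1_no_zero_divisors mat"
  assumes ore: "right_ore_domain TYPE('a)" and A: "A \<in> carrier_mat N N"
    and inj: "\<And>v. v \<in> carrier_vec N \<Longrightarrow> A *\<^sub>v v = 0\<^sub>v N \<Longrightarrow> v = 0\<^sub>v N"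
  shows "\<exists>d B. d \<noteq> 0 \<and> B \<in> carrier_mat N N \<and> A * B = mat N N (\<lambda>(i, j). if i = j then d else 0)"
proof -
  have "\<exists>d v. d \<noteq> 0 \<and> v \<in> carrier_vec N \<and> A *\<^sub>v v = vec N (\<lambda>i. if i = k then d else 0)" for k
  proof -
    \<comment> \<open>Column \<open>N\<close> is the negated unit vector, so that a relation reads \<open>A *\<^sub>v v = e\<^sub>k * x N\<close>.\<close>
    define f where "f i j = (if j = N then if i = k then - 1 else 0 else A $$ (i, j))" for i j :: nat
    obtain x where x: "\<exists>j\<in>{..N}. x j \<noteq> 0" "\<forall>i<N. (\<Sum>j\<in>{..N}. f i j * x j) = 0"
      using right_ore_columns_dependent[OF ore, of "{..N}" N f] by auto
    define v where "v = vec N x"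
    have v: "v \<in> carrier_vec N" by (simp add: v_def)
    have Av: "A *\<^sub>v v = vec N (\<lambda>i. if i = k then x N else 0)"
    proof (intro eq_vecI)
      fix i assume "i < dim_vec (vec N (\<lambda>i. if i = k then x N else 0))"
      then have i: "i < N" by simp
      have "(A *\<^sub>v v) $ i = (\<Sum>j<N. f i j * x j)"
        using i A by (auto simp: scalar_prod_def v_def f_def lessThan_atLeast0 intro!: sum.cong)
      moreover have "(\<Sum>j<N. f i j * x j) + f i N * x N = 0"
        using x(2) i by (auto simp: lessThan_Suc_atMost[symmetric])
      ultimately show "(A *\<^sub>v v) $ i = vec N (\<lambda>i. if i = k then x N else 0) $ i"
        using i by (auto simp: f_def)
    qed (use A in auto)
    have "x N \<noteq> 0"
    proof
      assume 0: "x N = 0"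
      then have "A *\<^sub>v v = 0\<^sub>v N" by (auto simp: Av)
      from inj[OF v this] have "x j = 0" if "j < N" for j
        using that by (metis v_def index_vec index_zero_vec(1))
      then show False using x(1) 0 by (metis atMost_iff le_neq_implies_less)
    qed
    then show ?thesis using v Av by blast
  qed
  then obtain d v where d: "\<And>k. d k \<noteq> 0" and v: "\<And>k. v k \<in> carrier_vec N"
    and Av: "\<And>k. A *\<^sub>v v k = vec N (\<lambda>i. if i = k then d k else 0)" by metis
  obtain c s where c: "c \<noteq> 0" and s: "\<And>k. k < N \<Longrightarrow> d k * s k = c"
    using right_ore_finite_common_multiple[OF ore, of N d] d by auto
  define B where "B = mat N N (\<lambda>(i, k). v k $ i * s k)"
  have "A * B = mat N N (\<lambda>(i, j). if i = j then c else 0)"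
  proof (intro eq_matI)
    fix i k assume "i < dim_row (mat N N (\<lambda>(i, j). if i = j then c else 0))"
      "k < dim_col (mat N N (\<lambda>(i, j). if i = j then c else 0))"
    then have ik: "i < N" "k < N" by auto
    have "(A * B) $$ (i, k) = (\<Sum>j\<in>{0..<N}. A $$ (i, j) * (v k $ j * s k))"
      using ik A by (auto simp: B_def scalar_prod_def intro!: sum.cong)
    also have "\<dots> = (A *\<^sub>v v k) $ i * s k"
      using ik A v[of k]
      by (auto simp: scalar_prod_def sum_distrib_right mult.assoc intro!: sum.cong)
    also have "\<dots> = (if i = k then c else 0)" using ik s by (auto simp: Av)
    finally show "(A * B) $$ (i, k) = mat N N (\<lambda>(i, j). if i = j then c else 0) $$ (i, k)"
      using ik by simp
  qed (use A in \<open>auto simp: B_def\<close>)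
  then show ?thesis using c by (intro exI[of _ c] exI[of _ B]) (auto simp: B_def)
qed

lemma non_zero_divisor_mult_vec_eq_0:
  fixes A :: "'a::ring_1 mat"
  assumes "non_zero_divisor (ring_mat TYPE('a) N ()) A"
    and v: "v \<in> carrier_vec N" "A *\<^sub>v v = 0\<^sub>v N"
  shows "v = 0\<^sub>v N"
proof -
  have A: "A \<in> carrier_mat N N"
    using assms(1) by (simp add: non_zero_divisor_def ring_mat_simps)
  \<comment> \<open>The hypothesis speaks of square matrices, so \<open>v\<close> is repeated as every column.\<close>
  define V where "V = mat N N (\<lambda>(i, j). v $ i)"
  have "A * V = 0\<^sub>m N N"
  proof (intro eq_matI)
    fix i j assume "i < dim_row (0\<^sub>m N N :: 'a mat)" "j < dim_col (0\<^sub>m N N :: 'a mat)"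
    moreover from this have "col V j = v" using v by (auto simp: V_def)
    moreover have "(A *\<^sub>v v) $ i = 0" if "i < N" using v that by simp
    ultimately show "(A * V) $$ (i, j) = 0\<^sub>m N N $$ (i, j)" using A by (auto simp: V_def)
  qed (use A in \<open>auto simp: V_def\<close>)
  moreover have "V \<in> carrier_mat N N" by (simp add: V_def)
  ultimately have "V = 0\<^sub>m N N"
    using assms(1) by (auto simp: non_zero_divisor_def ring_mat_simps)
  then have "V $$ (i, i) = 0" if "i < N" for i using that by simp
  then show ?thesis using v by (auto simp: V_def)
qed

section \<open>Block matrices in the general linear group\<close>

lemma GL_I:
  fixes S T :: "'a::ring_1 mat"
  assumes "S \<in> carrier_mat N N" "T \<in> carrier_mat N N" "S * T = 1\<^sub>m N" "T * S = 1\<^sub>m N"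
  shows "S \<in> GL TYPE('a) N"
  using assms unfolding GL_def Units_def by (auto simp: ring_mat_simps)

lemma GL_carrier: "S \<in> GL TYPE('a::ring_1) N \<Longrightarrow> S \<in> carrier_mat N N"
  unfolding GL_def Units_def by (auto simp: ring_mat_simps)

lemma GL_inverse:
  fixes S :: "'a::ring_1 mat"
  assumes "S \<in> GL TYPE('a) N"
  obtains T where "T \<in> GL TYPE('a) N" "S * T = 1\<^sub>m N" "T * S = 1\<^sub>m N"
  using assms unfolding GL_def Units_def by (auto simp: ring_mat_simps)

lemma GL_mult:
  fixes S T :: "'a::ring_1 mat"
  assumes "S \<in> GL TYPE('a) N" "T \<in> GL TYPE('a) N"
  shows "S * T \<in> GL TYPE('a) N"
proof -
  interpret semiring "ring_mat TYPE('a) N ()" by (rule semiring_mat)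
  show ?thesis using Units_m_closed assms by (simp add: GL_def ring_mat_simps)
qed

lemma block_lower_unitriangular_in_GL:
  fixes b :: "'a::ring_1 mat"
  assumes b: "b \<in> carrier_mat m n"
  shows "four_block_mat (1\<^sub>m n) (0\<^sub>m n m) b (1\<^sub>m m) \<in> GL TYPE('a) (n + m)"
proof -
  have *: "four_block_mat (1\<^sub>m n) (0\<^sub>m n m) c (1\<^sub>m m) * four_block_mat (1\<^sub>m n) (0\<^sub>m n m) d (1\<^sub>m m)
      = four_block_mat (1\<^sub>m n) (0\<^sub>m n m) (c + d) (1\<^sub>m m)"
    if "c \<in> carrier_mat m n" "d \<in> carrier_mat m n" for c d :: "'a mat"
    using that by (subst mult_four_block_mat[where ?nr1.0 = n and ?n1.0 = n and ?n2.0 = m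
      and ?nr2.0 = m and ?nc1.0 = n and ?nc2.0 = m]) auto
  have "b + - b = 0\<^sub>m m n" "- b + b = 0\<^sub>m m n" using b by auto
  then show ?thesis
    using b by (intro GL_I[of _ _ "four_block_mat (1\<^sub>m n) (0\<^sub>m n m) (- b) (1\<^sub>m m)"]) (auto simp: *)
qed

lemma block_upper_unitriangular_in_GL:
  fixes b :: "'a::ring_1 mat"
  assumes b: "b \<in> carrier_mat n m"
  shows "four_block_mat (1\<^sub>m n) b (0\<^sub>m m n) (1\<^sub>m m) \<in> GL TYPE('a) (n + m)"
proof -
  have *: "four_block_mat (1\<^sub>m n) c (0\<^sub>m m n) (1\<^sub>m m) * four_block_mat (1\<^sub>m n) d (0\<^sub>m m n) (1\<^sub>m m)
      = four_block_mat (1\<^sub>m n) (d + c) (0\<^sub>m m n) (1\<^sub>m m)"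
    if "c \<in> carrier_mat n m" "d \<in> carrier_mat n m" for c d :: "'a mat"
    using that by (subst mult_four_block_mat[where ?nr1.0 = n and ?n1.0 = n and ?n2.0 = m
      and ?nr2.0 = m and ?nc1.0 = n and ?nc2.0 = m]) auto
  have "b + - b = 0\<^sub>m n m" "- b + b = 0\<^sub>m n m" using b by auto
  then show ?thesis
    using b by (intro GL_I[of _ _ "four_block_mat (1\<^sub>m n) (- b) (0\<^sub>m m n) (1\<^sub>m m)"]) (auto simp: *)
qed

lemma block_swap_in_GL:
  "four_block_mat (0\<^sub>m n m) (1\<^sub>m n) (1\<^sub>m m) (0\<^sub>m m n) \<in> GL TYPE('a::ring_1) (n + m)"
proof -
  have *: "four_block_mat (0\<^sub>m n m) (1\<^sub>m n) (1\<^sub>m m) (0\<^sub>m m n) *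
      four_block_mat (0\<^sub>m m n) (1\<^sub>m m) (1\<^sub>m n) (0\<^sub>m n m) = (1\<^sub>m (n + m) :: 'a mat)" for n m
    by (subst mult_four_block_mat[where ?nr1.0 = n and ?n1.0 = m and ?n2.0 = n
      and ?nr2.0 = m and ?nc1.0 = n and ?nc2.0 = m]) auto
  have c: "four_block_mat (0\<^sub>m n m) (1\<^sub>m n) (1\<^sub>m m) (0\<^sub>m m n) \<in> carrier_mat (n + m) (n + m)" for n m
    by (auto intro!: carrier_matI)
  show ?thesis
    using *[of n m] *[of m n] c[of n m] c[of m n]
    by (intro GL_I[of _ _ "four_block_mat (0\<^sub>m m n) (1\<^sub>m m) (1\<^sub>m n) (0\<^sub>m n m)"]) (auto simp: add.commute)
qed

text \<open>Cut in two, a row becomes a block matrix whose lower blocks have no rows; the multiplication rule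
  for block matrices then applies to it.\<close>

abbreviation row_block :: "'a::zero mat \<Rightarrow> 'a mat \<Rightarrow> 'a mat" where
  "row_block a b \<equiv> four_block_mat a b (0\<^sub>m 0 (dim_col a)) (0\<^sub>m 0 (dim_col b))"

lemma row_block_mult:
  fixes a b :: "'a::semiring_0 mat"
  assumes "a \<in> carrier_mat r p" "b \<in> carrier_mat r q"
    "A \<in> carrier_mat p s" "B \<in> carrier_mat p t" "C \<in> carrier_mat q s" "D \<in> carrier_mat q t"
  shows "row_block a b * four_block_mat A B C D = row_block (a * A + b * C) (a * B + b * D)"
  using assms
  by (subst mult_four_block_mat[where ?nr1.0 = r and ?n1.0 = p and ?n2.0 = q
      and ?nr2.0 = 0 and ?nc1.0 = s and ?nc2.0 = t]) (auto intro!: cong_four_block_mat eq_matI)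

section \<open>Unimodular rows under stable range\<close>

abbreviation first_unit_row :: "nat \<Rightarrow> 'a::ring_1 mat" where
  "first_unit_row n \<equiv> row_block (1\<^sub>m 1) (0\<^sub>m 1 n)"

lemma unimodular_row_of_right_inverse:
  fixes U W :: "'a::ring_1 mat"
  assumes U: "U \<in> carrier_mat 1 k" and W: "W \<in> carrier_mat k 1" and UW: "U * W = 1\<^sub>m 1"
  shows "unimodular_row (row U 0)"
proof -
  have "\<exists>r. x = row U 0 \<bullet> r \<and> r \<in> carrier_vec k" for x
  proof (intro exI conjI)
    have "row U 0 \<bullet> vec k (\<lambda>i. W $$ (i, 0) * x) = (row U 0 \<bullet> col W 0) * x"
      using U W by (auto simp: scalar_prod_def sum_distrib_right mult.assoc intro!: sum.cong)
    also have "row U 0 \<bullet> col W 0 = (U * W) $$ (0, 0)" using U W by simp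
    finally show "x = row U 0 \<bullet> vec k (\<lambda>i. W $$ (i, 0) * x)" by (simp add: UW)
  qed simp
  then show ?thesis using U by (auto simp: unimodular_row_def)
qed

text \<open>
  Reducibility turns \<open>(a, c)\<close> into \<open>(a', c)\<close> with \<open>a'\<close> already unimodular. Adding a suitable right
  linear combination of the entries of \<open>a'\<close> to the last entry then changes it to \<open>1\<close>, which clears
  all the other entries.
\<close>

lemma unimodular_row_to_first_unit_row:
  fixes U W :: "'a::ring_1 mat"
  assumes red: "unimodular_rows_reducible TYPE('a) (n + 1)"
    and U: "U \<in> carrier_mat 1 (n + 1)" and W: "W \<in> carrier_mat (n + 1) 1" and UW: "U * W = 1\<^sub>m 1"
  shows "\<exists>T \<in> GL TYPE('a) (n + 1). U * T = first_unit_row n"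
proof -
  have "row U 0 \<in> carrier_vec (n + 1)" using U by (intro carrier_vecI) simp
  then have "reducible_row (row U 0)"
    using red unimodular_row_of_right_inverse[OF U W UW]
    by (simp add: unimodular_rows_reducible_def)
  then obtain b0 where "unimodular_row (vec n (\<lambda>i. row U 0 $ i + row U 0 $ n * b0 $ i))"
      (is "unimodular_row ?v")
    using U by (auto simp: reducible_row_def)
  then have "1 \<in> {?v \<bullet> r | r. r \<in> carrier_vec n}"
    by (simp add: unimodular_row_def)
  then obtain r0 where r0: "r0 \<in> carrier_vec n" "1 = ?v \<bullet> r0" by blast
  define a where "a = mat 1 n (\<lambda>(_, j). U $$ (0, j))"
  define c where "c = mat 1 1 (\<lambda>_. U $$ (0, n))"
  define b where "b = mat 1 n (\<lambda>(_, j). b0 $ j)"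
  define r where "r = mat n 1 (\<lambda>(i, _). r0 $ i)"
  define a' where "a' = a + c * b"
  have carr: "a \<in> carrier_mat 1 n" "c \<in> carrier_mat 1 1" "b \<in> carrier_mat 1 n" "r \<in> carrier_mat n 1"
    "a' \<in> carrier_mat 1 n"
    by (auto simp: a_def b_def c_def r_def a'_def)
  have U_eq: "U = row_block a c"
    using U by (intro eq_matI) (auto simp: a_def c_def less_Suc_eq)
  have a'_eq: "row a' 0 = vec n (\<lambda>i. row U 0 $ i + row U 0 $ n * b0 $ i)"
    using U by (intro eq_vecI) (auto simp: a'_def a_def b_def c_def scalar_prod_def)
  have col_r: "col r 0 = r0"
    using r0 by (intro eq_vecI) (auto simp: r_def)
  have a'r: "a' * r = 1\<^sub>m 1"
    using carr r0(2) by (intro eq_matI) (auto simp: a'_eq col_r)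
  \<comment> \<open>\<open>(a, c)\<close> becomes in turn \<open>(a', c)\<close>, \<open>(a', 1)\<close>, \<open>(0, 1)\<close> and \<open>(1, 0)\<close>.\<close>
  define T1 where "T1 = four_block_mat (1\<^sub>m n) (0\<^sub>m n 1) b (1\<^sub>m 1)"
  define T2 where "T2 = four_block_mat (1\<^sub>m n) (r * (1\<^sub>m 1 - c)) (0\<^sub>m 1 n) (1\<^sub>m 1)"
  define T3 where "T3 = four_block_mat (1\<^sub>m n) (0\<^sub>m n 1) (- a') (1\<^sub>m 1)"
  define T4 :: "'a mat" where "T4 = four_block_mat (0\<^sub>m n 1) (1\<^sub>m n) (1\<^sub>m 1) (0\<^sub>m 1 n)"
  have T: "T1 \<in> GL TYPE('a) (n + 1)" "T2 \<in> GL TYPE('a) (n + 1)" "T3 \<in> GL TYPE('a) (n + 1)"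
    "T4 \<in> GL TYPE('a) (n + 1)"
    unfolding T1_def T2_def T3_def T4_def using carr
    by (auto intro!: block_lower_unitriangular_in_GL block_upper_unitriangular_in_GL
        block_swap_in_GL simp del: One_nat_def)
  have 1: "U * T1 = row_block a' c"
    unfolding U_eq T1_def using carr
    by (subst row_block_mult[where r = 1 and p = n and q = 1 and s = n and t = 1]) (auto simp: a'_def)
  have c': "1\<^sub>m 1 - c \<in> carrier_mat 1 1" using carr by auto
  have "a' * (r * (1\<^sub>m 1 - c)) = 1\<^sub>m 1 - c"
    using assoc_mult_mat[OF carr(5,4) c'] left_mult_one_mat[OF c'] by (metis a'r)
  moreover have "1\<^sub>m 1 - c + c = 1\<^sub>m 1" using carr by (intro eq_matI) auto
  ultimately have 2: "row_block a' c * T2 = row_block a' (1\<^sub>m 1)"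
    unfolding T2_def using carr
    by (subst row_block_mult[where r = 1 and p = n and q = 1 and s = n and t = 1]) auto
  have "a' + - a' = 0\<^sub>m 1 n" using carr by auto
  then have 3: "row_block a' (1\<^sub>m 1) * T3 = row_block (0\<^sub>m 1 n) (1\<^sub>m 1)"
    unfolding T3_def using carr
    by (subst row_block_mult[where r = 1 and p = n and q = 1 and s = n and t = 1]) auto
  have 4: "row_block (0\<^sub>m 1 n) (1\<^sub>m 1) * T4 = first_unit_row n"
    unfolding T4_def
    by (subst row_block_mult[where r = 1 and p = n and q = 1 and s = 1 and t = n]) auto
  have "U * (T1 * T2 * T3 * T4) = U * T1 * T2 * T3 * T4"
    using T[THEN GL_carrier] U
    by (simp add: assoc_mult_mat[of _ 1 "n + 1" _ "n + 1" _ "n + 1"]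
        assoc_mult_mat[of _ "n + 1" "n + 1" _ "n + 1" _ "n + 1"] mult_carrier_mat[of _ _ "n + 1"])
  then have "U * (T1 * T2 * T3 * T4) = first_unit_row n" by (simp only: 1 2 3 4)
  moreover have "T1 * T2 * T3 * T4 \<in> GL TYPE('a) (n + 1)" using T by (intro GL_mult)
  ultimately show ?thesis by blast
qed

section \<open>Splitting off a unit\<close>

lemma clear_first_column:
  fixes M :: "'a::ring_1 mat"
  assumes M: "M \<in> carrier_mat (n + 1) (n + 1)" and row: "first_unit_row n * M = first_unit_row n"
  shows "\<exists>L \<in> GL TYPE('a) (n + 1). \<exists>A0 \<in> carrier_mat n n.
    L * M = four_block_mat (1\<^sub>m 1) (0\<^sub>m 1 n) (0\<^sub>m n 1) A0"
proof -
  obtain m11 m12 c D where "split_block M 1 1 = (m11, m12, c, D)" by (metis prod_cases4)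
  from split_block[OF this, of n n] M
  have carr: "m11 \<in> carrier_mat 1 1" "m12 \<in> carrier_mat 1 n" "c \<in> carrier_mat n 1"
      "D \<in> carrier_mat n n" and M_eq: "M = four_block_mat m11 m12 c D" by auto
  have "first_unit_row n * M = row_block m11 m12"
    unfolding M_eq using carr
    by (subst row_block_mult[where r = 1 and p = 1 and q = n and s = 1 and t = n]) auto
  then have eq: "row_block m11 m12 = first_unit_row n" using row by simp
  have "m11 $$ (0, 0) = 1"
    using arg_cong[OF eq, of "\<lambda>X. X $$ (0, 0)"] carr by simp
  then have m11: "m11 = 1\<^sub>m 1" using carr by (intro eq_matI) auto
  have m12: "m12 = 0\<^sub>m 1 n"
  proof (intro eq_matI)
    fix i j assume "i < dim_row (0\<^sub>m 1 n :: 'a mat)" "j < dim_col (0\<^sub>m 1 n :: 'a mat)"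
    then show "m12 $$ (i, j) = 0\<^sub>m 1 n $$ (i, j)"
      using arg_cong[OF eq, of "\<lambda>X. X $$ (0, j + 1)"] carr by simp
  qed (use carr in auto)
  define L where "L = four_block_mat (1\<^sub>m 1) (0\<^sub>m 1 n) (- c) (1\<^sub>m n)"
  have "- c + c = 0\<^sub>m n 1" using carr by auto
  then have "L * M = four_block_mat (1\<^sub>m 1) (0\<^sub>m 1 n) (0\<^sub>m n 1) D"
    unfolding L_def M_eq m11 m12 using carr
    by (subst mult_four_block_mat[where ?nr1.0 = 1 and ?n1.0 = 1 and ?n2.0 = n
      and ?nr2.0 = n and ?nc1.0 = 1 and ?nc2.0 = n]) auto
  moreover have "L \<in> GL TYPE('a) (n + 1)"
    using block_lower_unitriangular_in_GL[of "- c" n 1] carr by (simp add: L_def)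
  ultimately show ?thesis using carr by blast
qed

text \<open>
  Both \<open>u\<close> and \<open>u * A\<close> have right inverses, namely \<open>A * v\<close> and \<open>v\<close>. Hence \<open>u\<close> is the first row of
  some invertible \<open>P\<close>, and column operations turn \<open>u * A\<close>, the first row of \<open>P * A\<close>, into the first
  unit row.
\<close>

lemma split_off_unit:
  fixes A u v :: "'a::ring_1 mat"
  assumes red: "unimodular_rows_reducible TYPE('a) (n + 1)"
    and A: "A \<in> carrier_mat (n + 1) (n + 1)"
    and u: "u \<in> carrier_mat 1 (n + 1)" and v: "v \<in> carrier_mat (n + 1) 1"
    and uAv: "u * A * v = 1\<^sub>m 1"
  shows "\<exists>P \<in> GL TYPE('a) (n + 1). \<exists>Q \<in> GL TYPE('a) (n + 1). \<exists>A0 \<in> carrier_mat n n.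
    P * A * Q = four_block_mat (1\<^sub>m 1) (0\<^sub>m 1 n) (0\<^sub>m n 1) A0"
proof -
  let ?N = "n + 1" and ?e = "first_unit_row n :: 'a mat"
  have uA: "u * A \<in> carrier_mat 1 ?N" and Av: "A * v \<in> carrier_mat ?N 1"
    using u v A by (auto intro: mult_carrier_mat)
  obtain Q where Q: "Q \<in> GL TYPE('a) ?N" and uAQ: "u * A * Q = ?e"
    using unimodular_row_to_first_unit_row[OF red uA v uAv] by blast
  have "u * (A * v) = 1\<^sub>m 1" using uAv assoc_mult_mat[OF u A v] by simp
  then obtain T where T: "T \<in> GL TYPE('a) ?N" and uT: "u * T = ?e"
    using unimodular_row_to_first_unit_row[OF red u Av] by blast
  obtain P where P: "P \<in> GL TYPE('a) ?N" and TP: "T * P = 1\<^sub>m ?N"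
    using GL_inverse[OF T] .
  note carr = P[THEN GL_carrier] Q[THEN GL_carrier] T[THEN GL_carrier]
  have PA: "P * A \<in> carrier_mat ?N ?N" and PAQ: "P * A * Q \<in> carrier_mat ?N ?N"
    using carr A by (auto intro: mult_carrier_mat)
  have e: "?e \<in> carrier_mat 1 ?N" by (auto intro!: carrier_matI)
  have "?e * P = u"
    using assoc_mult_mat[OF u carr(3,1)] u by (simp add: uT TP)
  then have "?e * (P * A * Q) = ?e"
    using assoc_mult_mat[OF e PA carr(2)] assoc_mult_mat[OF e carr(1) A] uAQ by simp
  from clear_first_column[OF PAQ this] obtain L A0
    where L: "L \<in> GL TYPE('a) ?N" and A0: "A0 \<in> carrier_mat n n"
      and LM: "L * (P * A * Q) = four_block_mat (1\<^sub>m 1) (0\<^sub>m 1 n) (0\<^sub>m n 1) A0" by blast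
  have "L * P * A * Q = L * (P * A * Q)"
    using assoc_mult_mat[OF GL_carrier[OF L] PA carr(2)]
      assoc_mult_mat[OF GL_carrier[OF L] carr(1) A] by simp
  then show ?thesis using LM GL_mult[OF L P] Q A0 by metis
qed

theorem theorem2:
  fixes n :: nat and A :: "'a::ring_1_no_zero_divisors mat"
  assumes "1 \<le> n"
    and "ore_domain TYPE('a)"
    and "m_simple TYPE('a) (n + 1)"
    and "has_stable_range TYPE('a) n"
    and "A \<in> carrier_mat (n + 1) (n + 1)"
    and "non_zero_divisor (ring_mat TYPE('a) (n + 1) ()) A"
  shows "\<exists>P \<in> GL TYPE('a) (n + 1). \<exists>Q \<in> GL TYPE('a) (n + 1). \<exists>A0 \<in> carrier_mat n n.
    P * A * Q = four_block_mat (1\<^sub>m 1) (0\<^sub>m 1 n) (0\<^sub>m n 1) A0"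
proof -
  let ?N = "n + 1"
  note A = assms(5)
  have "right_ore_domain TYPE('a)" using assms(2) by (simp add: ore_domain_def)
  from scalar_right_multiple[OF this A non_zero_divisor_mult_vec_eq_0[OF assms(6)]]
  obtain d B where d: "d \<noteq> 0" and B: "B \<in> carrier_mat ?N ?N"
    and AB: "A * B = mat ?N ?N (\<lambda>(i, j). if i = j then d else 0)" by blast
  obtain p q where pq: "(\<Sum>i = 1..?N. p i * d * q i) = 1"
    using assms(3) d by (auto simp: m_simple_def one_as_sum_of_multiples_def)
  define u where "u = mat 1 ?N (\<lambda>(_, j). p (Suc j))"
  define w where "w = mat ?N 1 (\<lambda>(i, _). q (Suc i))"
  have u: "u \<in> carrier_mat 1 ?N" and w: "w \<in> carrier_mat ?N 1" by (simp_all add: u_def w_def)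
  have "u * (A * B) = mat 1 ?N (\<lambda>(_, j). p (Suc j) * d)"
  proof (intro eq_matI)
    fix i j assume "i < dim_row (mat 1 ?N (\<lambda>(_, j). p (Suc j) * d))"
      "j < dim_col (mat 1 ?N (\<lambda>(_, j). p (Suc j) * d))"
    then have i: "i = 0" and j: "j < ?N" by auto
    have "(u * (A * B)) $$ (i, j) = (\<Sum>k\<in>{0..<?N}. p (Suc k) * (if k = j then d else 0))"
      using i j by (auto simp: AB u_def scalar_prod_def intro!: sum.cong)
    also have "\<dots> = (\<Sum>k\<in>{0..<?N}. if k = j then p (Suc k) * d else 0)"
      by (intro sum.cong) auto
    finally show "(u * (A * B)) $$ (i, j) = mat 1 ?N (\<lambda>(_, j). p (Suc j) * d) $$ (i, j)"
      using i j by simp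
  qed (auto simp: AB u_def)
  then have "u * (A * B) * w = 1\<^sub>m 1"
    using pq sum.shift_bounds_Suc_ivl[of "\<lambda>i. p i * d * q i" 0 ?N]
    by (intro eq_matI) (auto simp: w_def scalar_prod_def atLeastLessThanSuc_atLeastAtMost)
  moreover have "u * (A * B) * w = u * A * (B * w)"
    using assoc_mult_mat[OF u A B] assoc_mult_mat[OF mult_carrier_mat[OF u A] B w] by simp
  ultimately have "u * A * (B * w) = 1\<^sub>m 1" by simp
  moreover have "unimodular_rows_reducible TYPE('a) ?N"
    using assms(4) by (simp add: has_stable_range_def)
  ultimately show ?thesis
    using split_off_unit[OF _ A u mult_carrier_mat[OF B w]] by blast
qed

end
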